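(* Let $X$ be a Banach space admitting an equivalent norm that is Fréchet differentiable off the origin, let $m\ge2$, and let $\bar{x}$ be a rated extremal point of rank $\alpha\in[0,1)$ for a system of sets $\Omega_1,\ldots,\Omega_m\subset X$ locally closed around $\bar{x}$. Then the approximate extremal principle holds for $\{\Omega_1,\ldots,\Omega_m\}$ at $\bar{x}$; that is, for every $\varepsilon>0$ there are $x_i\in\Omega_i\cap(\bar{x}+\varepsilon\mathbb{B})$ and $x_i^*\in\widehat{N}(x_i;\Omega_i)+\varepsilon\mathbb{B}^*$, $i=1,\ldots,m$, such that $$x_1^*+\ldots+x_m^*=0\quad\text{and}\quad\|x_1^*\|^2+\ldots+\|x_m^*\|^2=1.$$
   Context: $\mathbb{B}$ and $\mathbb{B}^*$ are the closed unit balls of $X$ and its dual $X^*$; $B(\bar{x},\rho)$ is the closed ball centered at $\bar{x}$ with radius $\rho$. Rated extremality: for nonempty sets $\Omega_1,\ldots,\Omega_m\subset X$ with common point $\bar{x}$, $\bar{x}$ is a rated extremal point of rank $\alpha$, $0\le\alpha<1$, of $\{\Omega_1,\ldots,\Omega_m\}$ if there are $\gamma>0$ and sequences $\{a_{ik}\}_{k\in\mathbb{N}}\subset X$, $i=1,\ldots,m$, such that $r_k:=\max_i\|a_{ik}\|\to0$ as $k\to\infty$ and $\bigcap_{i=1}^m(\Omega_i-a_{ik})\cap B(\bar{x},\gamma r_k^\alpha)=\emptyset$ for all large $k\in\mathbb{N}$. Fréchet normal cone: $\widehat{N}(x;\Omega):=\{x^*\in X^*\mid\limsup_{u\to x,\,u\in\Omega}\frac{\langle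 x^*,u-x\rangle}{\|u-x\|}\le0\}$ for $x\in\Omega$. *)

theory Defs
  imports "HOL-Analysis.Analysis" "HOL-Library.Set_Algebras"
begin

definition equivalent_norm :: "('a::real_normed_vector \<Rightarrow> real) \<Rightarrow> bool" where
  "equivalent_norm N \<longleftrightarrow>
     (\<forall>x. N x = 0 \<longleftrightarrow> x = 0) \<and>
     (\<forall>c x. N (c *\<^sub>R x) = \<bar>c\<bar> * N x) \<and>
     (\<forall>x y. N (x + y) \<le> N x + N y) \<and>
     (\<exists>c>0. \<exists>C>0. \<forall>x. c * norm x \<le> N x \<and> N x \<le> C * norm x)"

text \<open>Differentiability below is taken with respect to the ambient norm of the type; this agrees
  with differentiability with respect to \<open>N\<close>, since the two norms are equivalent.\<close>

definition has_equivalent_frechet_smooth_norm :: "'a::real_normed_vector itself \<Rightarrow> bool" where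
  "has_equivalent_frechet_smooth_norm _ \<longleftrightarrow>
     (\<exists>N :: 'a \<Rightarrow> real. equivalent_norm N \<and> (\<forall>x. x \<noteq> 0 \<longrightarrow> N differentiable (at x)))"

definition locally_closed_around :: "'a::metric_space set \<Rightarrow> 'a \<Rightarrow> bool" where
  "locally_closed_around S x \<longleftrightarrow> (\<exists>\<rho>>0. closed (S \<inter> cball x \<rho>))"

text \<open>The dual space is the space of bounded linear functionals \<open>'a \<Rightarrow>\<^sub>L real\<close> with the operator norm.
  The upper limit is taken in the extended reals over \<open>u \<noteq> x\<close>; at an isolated point of the
  set it is \<open>-\<infinity>\<close>, so that the cone is the whole dual. Only points \<open>x \<in> S\<close> are meaningful.\<close>

definition frechet_normal_cone ::
    "'a::real_normed_vector \<Rightarrow> 'a set \<Rightarrow> ('a \<Rightarrow>\<^sub>L real) set" where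
  "frechet_normal_cone x S =
     {x'. Limsup (at x within S) (\<lambda>u. ereal (blinfun_apply x' (u - x) / norm (u - x))) \<le> 0}"

text \<open>Systems of \<open>m\<close> sets are indexed by \<open>{1..m}\<close>. Note that \<open>r k = 0\<close> makes all shifts zero and the
  intersection contains the common point, so the value of \<open>0 powr \<alpha>\<close> is immaterial.\<close>

definition rated_extremal_point ::
    "real \<Rightarrow> nat \<Rightarrow> (nat \<Rightarrow> 'a::real_normed_vector set) \<Rightarrow> 'a \<Rightarrow> bool" where
  "rated_extremal_point \<alpha> m \<Omega> x \<longleftrightarrow>
     0 \<le> \<alpha> \<and> \<alpha> < 1 \<and> (\<forall>i\<in>{1..m}. x \<in> \<Omega> i) \<and>
     (\<exists>\<gamma>>0. \<exists>a :: nat \<Rightarrow> nat \<Rightarrow> 'a.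
        let r = (\<lambda>k. Max ((\<lambda>i. norm (a i k)) ` {1..m})) in
          r \<longlonglongrightarrow> 0 \<and>
          (\<forall>\<^sub>F k in sequentially.
             (\<Inter>i\<in>{1..m}. (\<lambda>y. y - a i k) ` \<Omega> i) \<inter> cball x (\<gamma> * r k powr \<alpha>) = {}))"

definition approximate_extremal_principle ::
    "nat \<Rightarrow> (nat \<Rightarrow> 'a::real_normed_vector set) \<Rightarrow> 'a \<Rightarrow> bool" where
  "approximate_extremal_principle m \<Omega> x \<longleftrightarrow>
     (\<forall>\<epsilon>>0. \<exists>(y :: nat \<Rightarrow> 'a) (y' :: nat \<Rightarrow> 'a \<Rightarrow>\<^sub>L real).
        (\<forall>i\<in>{1..m}. y i \<in> \<Omega> i \<inter> cball x \<epsilon> \<and>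
                    y' i \<in> frechet_normal_cone (y i) (\<Omega> i) + cball 0 \<epsilon>) \<and>
        (\<Sum>i=1..m. y' i) = 0 \<and>
        (\<Sum>i=1..m. (norm (y' i))\<^sup>2) = 1)"

end

theory Submission
  imports Defs
begin

text \<open>
  Minimize the \<open>\<ell>\<^sup>2\<close>-type distance \<open>f y = (\<Sum>k<m. N (y\<^sub>k - a\<^sub>k - (y\<^sub>m - a\<^sub>m))\<^sup>2)\<^sup>1\<^sup>/\<^sup>2\<close>, where \<open>N\<close> is the
  smooth norm, over the product of the sets near the extremal point, after a smooth perturbation as
  in the Borwein--Preiss variational principle. At the starting point \<open>f\<close> has order \<open>r\<close>, and moving
  by at most \<open>r powr \<beta>\<close> with \<open>\<alpha> < \<beta> < 1\<close> costs a perturbation of slope of order \<open>r powr (1 - \<beta>)\<close>.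
  Extremality forces \<open>f > 0\<close> at the minimizer, so \<open>f\<close> is differentiable there. Its partial
  derivatives sum to zero and cannot all be small since \<open>f\<close> is positively homogeneous in the
  differences, and by Fermat's rule in each coordinate their negatives are Frechet normals up to
  the slope of the perturbation. Normalizing them gives the claim.
\<close>

section \<open>Smooth variational principle with quadratic perturbations\<close>

text \<open>The set \<open>S\<close> stands for a product of sets whose number of factors is not fixed by a type; hence
  convergence in \<open>S\<close> is an abstract relation \<open>conv\<close> and completeness a hypothesis.\<close>

lemma smooth_variational_principle:
  fixes f :: "'z \<Rightarrow> real" and Q :: "'z \<Rightarrow> 'z \<Rightarrow> real"
    and conv :: "(nat \<Rightarrow> 'z) \<Rightarrow> 'z \<Rightarrow> bool"
  assumes z0: "z0 \<in> S" and f_nonneg: "\<And>w. w \<in> S \<Longrightarrow> 0 \<le> f w" and f_z0: "f z0 \<le> e"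
    and e: "0 < e" and c: "0 < c"
    and Q_nonneg: "\<And>v w. 0 \<le> Q v w" and Q_refl: "\<And>w. Q w w = 0"
    and Q_bounded: "\<And>v w. v \<in> S \<Longrightarrow> w \<in> S \<Longrightarrow> Q v w \<le> B"
    and complete: "\<And>z. (\<And>n. z n \<in> S) \<Longrightarrow> (\<And>n. Q (z (Suc n)) (z n) \<le> 4 * e / c * (1/8) ^ n) \<Longrightarrow>
      \<exists>zb\<in>S. conv z zb"
    and conv_f: "\<And>z zb. conv z zb \<Longrightarrow> (\<lambda>n. f (z n)) \<longlonglongrightarrow> f zb"
    and conv_Q: "\<And>z zb w. conv z zb \<Longrightarrow> (\<lambda>n. Q (z n) w) \<longlonglongrightarrow> Q zb w"
  obtains z zb where "\<And>n. z n \<in> S" "z 0 = z0" "zb \<in> S" "conv z zb"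
    "\<And>n. Q (z (Suc n)) (z n) \<le> 4 * e / c * (1/8) ^ n"
    "\<And>w. w \<in> S \<Longrightarrow> f zb + c * (\<Sum>j. (1/2) ^ Suc j * Q zb (z j))
        \<le> f w + c * (\<Sum>j. (1/2) ^ Suc j * Q w (z j))"
proof -
  \<comment> \<open>A state of the recursion pairs the perturbed function reached so far with an
    almost minimizer of it over \<open>S\<close>. The clause for \<open>n = 0\<close> fixes the
    initial state, which has tolerance \<open>e\<close> because \<open>f\<close> is nonnegative and
    \<open>f z0 \<le> e\<close>. The relation \<open>R\<close> adds the next penalty, centred at the
    current point.\<close>
  define P :: "nat \<Rightarrow> ('z \<Rightarrow> real) \<times> 'z \<Rightarrow> bool" where
    "P n s \<longleftrightarrow> snd s \<in> S \<and> (\<forall>w\<in>S. 0 \<le> fst s w) \<and> (\<forall>w\<in>S. fst s (snd s) \<le> fst s w + e / 16 ^ n)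
       \<and> (n = 0 \<longrightarrow> s = (f, z0))" for n s
  define R :: "nat \<Rightarrow> ('z \<Rightarrow> real) \<times> 'z \<Rightarrow> ('z \<Rightarrow> real) \<times> 'z \<Rightarrow> bool" where
    "R n s t \<longleftrightarrow> fst t = (\<lambda>w. fst s w + c * ((1/2) ^ Suc n * Q w (snd s)))" for n s t
  have P0: "\<exists>s. P 0 s"
    using z0 f_nonneg f_z0 by (intro exI[of _ "(f, z0)"]) (force simp: P_def)
  have step: "\<exists>t. P (Suc n) t \<and> R n s t" if s: "P n s" for n s
  proof -
    define g where "g = (\<lambda>w. fst s w + c * ((1/2) ^ Suc n * Q w (snd s)))"
    have g_nonneg: "0 \<le> g w" if "w \<in> S" for w
      using s that c Q_nonneg by (auto simp: g_def P_def)
    have bdd: "bdd_below (g ` S)"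
      using g_nonneg by (intro bdd_belowI2[where m = 0]) auto
    have "Inf (g ` S) < Inf (g ` S) + e / 16 ^ Suc n"
      using e by simp
    then obtain x where x: "x \<in> S" "g x < Inf (g ` S) + e / 16 ^ Suc n"
      using cInf_lessD[of "g ` S"] z0 by (smt (verit) empty_iff image_iff)
    have "g x \<le> g w + e / 16 ^ Suc n" if "w \<in> S" for w
      using x(2) cInf_lower[OF _ bdd, of "g w"] that by fastforce
    then show ?thesis
      using x(1) g_nonneg by (intro exI[of _ "(g, x)"]) (auto simp: P_def R_def g_def)
  qed
  obtain s where s: "\<And>n. P n (s n)" "\<And>n. R n (s n) (s (Suc n))"
    using dependent_nat_choice[of P R] P0 step by blast
  define z where "z n = snd (s n)" for n
  have fst_s: "fst (s n) = (\<lambda>w. f w + c * (\<Sum>j<n. (1/2) ^ Suc j * Q w (z j)))" for n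
  proof (induction n)
    case 0
    then show ?case using s(1)[of 0] by (simp add: P_def)
  next
    case (Suc n)
    then show ?case using s(2)[of n] by (simp add: R_def z_def algebra_simps)
  qed
  have zS: "z n \<in> S" for n
    using s(1)[of n] by (simp add: P_def z_def)
  have z_min: "fst (s n) (z n) \<le> fst (s n) w + e / 16 ^ n" if "w \<in> S" for n w
    using s(1)[of n] that by (simp add: P_def z_def)
  \<comment> \<open>The point \<open>z n\<close> pays no penalty centred at itself, while
    \<open>z (Suc n)\<close> almost minimizes the penalized function. So the penalty at
    \<open>z (Suc n)\<close> is at most the sum of two tolerances. Tolerances shrink by 16 and
    weights by 2, hence the ratio 1/8.\<close>
  have Q_step: "Q (z (Suc n)) (z n) \<le> 4 * e / c * (1/8) ^ n" for n
  proof -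
    have R: "fst (s (Suc n)) w = fst (s n) w + c * ((1/2) ^ Suc n * Q w (z n))" for w
      using s(2)[of n] by (simp add: R_def z_def)
    have "fst (s (Suc n)) (z (Suc n)) \<le> fst (s n) (z n) + e / 16 ^ Suc n"
      using z_min[OF zS, of "Suc n" n] R[of "z n"] by (simp add: Q_refl)
    moreover have "fst (s n) (z n) \<le> fst (s n) (z (Suc n)) + e / 16 ^ n"
      using z_min[OF zS] .
    moreover have "e / 16 ^ Suc n \<le> e / 16 ^ n"
      using e by (simp add: field_simps)
    ultimately have "c * ((1/2) ^ Suc n * Q (z (Suc n)) (z n)) \<le> 2 * (e / 16 ^ n)"
      using R[of "z (Suc n)"] by linarith
    also have "\<dots> = c * ((1/2) ^ Suc n * (4 * e / c * (1/8) ^ n))"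
      using c by (simp add: field_simps flip: power_mult_distrib)
    finally show ?thesis
      using c by (simp add: field_simps)
  qed
  obtain zb where zb: "zb \<in> S" "conv z zb"
    using complete[OF zS Q_step] by blast
  have summ: "summable (\<lambda>j. (1/2) ^ Suc j * Q w (z j))" if "w \<in> S" for w
  proof (rule summable_comparison_test')
    show "summable (\<lambda>j. (1/2) ^ Suc j * B :: real)"
      by (intro summable_mult2) simp
    show "norm ((1/2) ^ Suc j * Q w (z j)) \<le> (1/2) ^ Suc j * B" if "0 \<le> j" for j
      using Q_nonneg[of w "z j"] Q_bounded[OF \<open>w \<in> S\<close> zS[of j]] by (simp add: abs_mult)
  qed
  have min: "f zb + c * (\<Sum>j. (1/2) ^ Suc j * Q zb (z j))
        \<le> f w + c * (\<Sum>j. (1/2) ^ Suc j * Q w (z j))" (is "_ \<le> ?rhs") if w: "w \<in> S" for w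
  proof -
    have s_le: "fst (s n) w \<le> ?rhs" for n
      unfolding fst_s using sum_le_suminf[OF summ[OF w], of "{..<n}"] Q_nonneg c by simp
    \<comment> \<open>Convergence is known for each penalty separately. Hence the series is
      truncated at \<open>k\<close>, the limit in \<open>n\<close> is taken first, and
      \<open>k\<close> is released afterwards.\<close>
    have "f zb + c * (\<Sum>j<k. (1/2) ^ Suc j * Q zb (z j)) \<le> ?rhs" for k
    proof (rule LIMSEQ_le)
      show "(\<lambda>n. f (z n) + c * (\<Sum>j<k. (1/2) ^ Suc j * Q (z n) (z j)))
         \<longlonglongrightarrow> f zb + c * (\<Sum>j<k. (1/2) ^ Suc j * Q zb (z j))"
        by (intro tendsto_intros conv_f conv_Q zb)
      have "(\<lambda>n. e / 16 ^ n) \<longlonglongrightarrow> 0"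
        by (rule LIMSEQ_divide_realpow_zero) simp
      from tendsto_add[OF tendsto_const this]
      show "(\<lambda>n. ?rhs + e / 16 ^ n) \<longlonglongrightarrow> ?rhs"
        by simp
      show "\<exists>n0. \<forall>n\<ge>n0. f (z n) + c * (\<Sum>j<k. (1/2) ^ Suc j * Q (z n) (z j)) \<le> ?rhs + e / 16 ^ n"
      proof (intro exI[of _ k] allI impI)
        fix n assume "k \<le> n"
        then have "(\<Sum>j<k. (1/2) ^ Suc j * Q (z n) (z j)) \<le> (\<Sum>j<n. (1/2) ^ Suc j * Q (z n) (z j))"
          by (intro sum_mono2) (auto simp: Q_nonneg)
        then have "f (z n) + c * (\<Sum>j<k. (1/2) ^ Suc j * Q (z n) (z j)) \<le> fst (s n) (z n)"
          unfolding fst_s using c by simp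
        also have "\<dots> \<le> ?rhs + e / 16 ^ n"
          using z_min[OF w, of n] s_le[of n] by linarith
        finally show "f (z n) + c * (\<Sum>j<k. (1/2) ^ Suc j * Q (z n) (z j)) \<le> ?rhs + e / 16 ^ n" .
      qed
    qed
    moreover have "(\<lambda>k. f zb + c * (\<Sum>j<k. (1/2) ^ Suc j * Q zb (z j)))
        \<longlonglongrightarrow> f zb + c * (\<Sum>j. (1/2) ^ Suc j * Q zb (z j))"
      by (intro tendsto_add tendsto_mult tendsto_const summable_LIMSEQ summ zb(1))
    ultimately show ?thesis
      by (intro LIMSEQ_le_const2) auto
  qed
  have "z 0 = z0"
    using s(1)[of 0] by (simp add: P_def z_def)
  then show thesis
    by (rule that[OF zS _ zb Q_step min])
qed

section \<open>Frechet normals from minimization\<close>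

text \<open>Fermat's rule: at a local minimum on \<open>S\<close> the difference
  \<open>g u - g v\<close> is nonnegative, so the quotient of \<open>- D\<close> is dominated by the
  remainder quotient of the derivative, which tends to zero.\<close>

lemma frechet_normal_cone_of_local_min:
  fixes g :: "'a::real_normed_vector \<Rightarrow> real"
  assumes g: "(g has_derivative blinfun_apply D) (at v)"
    and min: "\<forall>\<^sub>F u in at v within S. g v \<le> g u"
  shows "- D \<in> frechet_normal_cone v S"
proof -
  have "\<forall>\<^sub>F u in at v within S. ereal (blinfun_apply (- D) (u - v) / norm (u - v)) < y"
    if "0 < y" for y :: ereal
  proof -
    \<comment> \<open>The threshold \<open>y\<close> is an extended real and may be infinite, so a
      real number below it is inserted.\<close>
    obtain t where t: "0 < t" "ereal t < y"
      using \<open>0 < y\<close> ereal_dense2[of 0 y] by auto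
    have "(g has_derivative blinfun_apply D) (at v within S)"
      using g by (rule has_derivative_at_withinI)
    then have "((\<lambda>u. (g u - g v - blinfun_apply D (u - v)) / norm (u - v)) \<longlongrightarrow> 0) (at v within S)"
      by (simp add: has_derivative_within divide_inverse_commute diff_diff_eq)
    then have "\<forall>\<^sub>F u in at v within S. (g u - g v - blinfun_apply D (u - v)) / norm (u - v) < t"
      using t(1) by (simp add: order_tendstoD(2))
    then show ?thesis
      using min
    proof eventually_elim
      case (elim u)
      have "blinfun_apply (- D) (u - v) / norm (u - v)
          \<le> (g u - g v - blinfun_apply D (u - v)) / norm (u - v)"
        using elim(2) by (intro divide_right_mono) (auto simp: blinfun.minus_left)
      then show ?case
        using elim(1) by (intro less_trans[OF _ t(2)]) simp
    qed
  qed
  then show ?thesis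
    unfolding frechet_normal_cone_def by (simp add: Limsup_le_iff)
qed

lemma frechet_normal_cone_scaleR:
  assumes "x' \<in> frechet_normal_cone x S" "0 < t"
  shows "t *\<^sub>R x' \<in> frechet_normal_cone x S"
proof -
  have "\<forall>\<^sub>F u in at x within S. ereal (blinfun_apply (t *\<^sub>R x') (u - x) / norm (u - x)) < y"
    if "0 < y" for y :: ereal
  proof -
    obtain s where s: "0 < s" "ereal s < y"
      using \<open>0 < y\<close> ereal_dense2[of 0 y] by auto
    have "\<forall>\<^sub>F u in at x within S. ereal (blinfun_apply x' (u - x) / norm (u - x)) < ereal (s / t)"
      using assms s(1) unfolding frechet_normal_cone_def Limsup_le_iff mem_Collect_eq
      by (auto elim!: allE[of _ "ereal (s / t)"])
    then show ?thesis
    proof eventually_elim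
      case (elim u)
      then have "blinfun_apply (t *\<^sub>R x') (u - x) / norm (u - x) < s"
        using assms(2) by (simp add: blinfun.scaleR_left field_simps)
      then show ?case
        by (intro less_trans[OF _ s(2)]) simp
    qed
  qed
  then show ?thesis
    unfolding frechet_normal_cone_def by (simp add: Limsup_le_iff)
qed

section \<open>Geometric series and sums with two nonzero coefficients\<close>

text \<open>Comparison with the geometric series, with the weights in the form used by the
  perturbation. The case \<open>n = 0\<close> bounds the full sum.\<close>

lemma geometric_series_tail:
  fixes a :: "nat \<Rightarrow> 'b::banach"
  assumes a: "\<And>j. norm (a j) \<le> K * (1/2) ^ Suc j"
  shows "summable a" "norm (suminf a - (\<Sum>j<n. a j)) \<le> K * (1/2) ^ n"
proof -
  have half: "(\<lambda>j. K * (1/2) ^ n * (1/2) ^ Suc j) sums (K * (1/2) ^ n)" for n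
    using sums_mult[OF power_half_series, of "K * (1/2) ^ n"] by (simp only: mult_1_right)
  have "norm (a j) \<le> K * (1/2) ^ 0 * (1/2) ^ Suc j" for j
    using a[of j] by (simp only: power_0 mult_1_right)
  then have *: "summable a"
    by (rule summable_comparison_test'[OF sums_summable[OF half]])
  have "norm (a (j + n)) \<le> K * (1/2) ^ n * (1/2) ^ Suc j" for j
    using a[of "j + n"] by (simp only: power_add power_Suc mult_ac)
  then have "norm (\<Sum>j. a (j + n)) \<le> (\<Sum>j. K * (1/2) ^ n * (1/2) ^ Suc j)"
    by (rule norm_suminf_le) (rule sums_summable[OF half])
  also have "\<dots> = K * (1/2) ^ n"
    using half by (rule sums_unique[symmetric])
  finally show "norm (suminf a - (\<Sum>j<n. a j)) \<le> K * (1/2) ^ n"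
    by (simp only: suminf_minus_initial_segment[OF *])
  show "summable a"
    by fact
qed

text \<open>The coefficients describe how a difference of the \<open>k\<close>-th and the
  \<open>m\<close>-th point reacts to each point. A constant \<open>g\<close> gives cancellation of
  the partial derivatives, and a varying \<open>g\<close> gives Euler's identity for them.\<close>

lemma sum_of_bool_diff_scaleR:
  fixes g :: "'i \<Rightarrow> 'b::real_vector"
  assumes "finite A" "k \<in> A" "m \<in> A"
  shows "(\<Sum>i\<in>A. (of_bool (i = k) - of_bool (i = m)) *\<^sub>R g i) = g k - g m"
proof -
  have "(of_bool (i = k) - of_bool (i = m)) *\<^sub>R g i = (if i = k then g i else 0) - (if i = m then g i else 0)" for i
    by (cases "i = k"; cases "i = m") simp_all
  then have "(\<Sum>i\<in>A. (of_bool (i = k) - of_bool (i = m)) *\<^sub>R g i)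
      = (\<Sum>i\<in>A. if i = k then g i else 0) - (\<Sum>i\<in>A. if i = m then g i else 0)"
    by (simp only: sum_subtractf)
  also have "\<dots> = g k - g m"
    using assms by (simp only: sum.delta if_True)
  finally show ?thesis .
qed

section \<open>The smooth equivalent norm\<close>

text \<open>\<open>N\<close> is kept as a plain function because completeness, derivatives and the
  dual norm refer to \<open>norm\<close>; the constants \<open>lo\<close> and \<open>hi\<close>
  translate between the two.\<close>

locale frechet_smooth_norm =
  fixes N :: "'a::banach \<Rightarrow> real" and lo hi :: real
  assumes N_eq_0: "N x = 0 \<longleftrightarrow> x = 0"
    and N_scaleR: "N (t *\<^sub>R x) = \<bar>t\<bar> * N x"
    and N_triangle: "N (x + y) \<le> N x + N y"
    and lo: "0 < lo" and hi: "0 < hi"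
    and lo_le: "lo * norm x \<le> N x" and le_hi: "N x \<le> hi * norm x"
    and N_differentiable: "x \<noteq> 0 \<Longrightarrow> N differentiable (at x)"
begin

lemma N_nonneg: "0 \<le> N x"
  using lo lo_le[of x] by (meson mult_nonneg_nonneg norm_ge_zero order_trans less_imp_le)

lemma N_0: "N 0 = 0"
  by (simp add: N_eq_0)

lemma N_minus: "N (- x) = N x"
  using N_scaleR[of "-1" x] by simp

lemma N_minus_commute: "N (x - y) = N (y - x)"
  using N_minus[of "x - y"] by simp

lemma N_reverse_triangle: "\<bar>N x - N y\<bar> \<le> N (x - y)"
  using N_triangle[of y "x - y"] N_triangle[of x "y - x"] N_minus_commute[of x y] by simp

lemma norm_le: "norm x \<le> N x / lo"
  using lo lo_le[of x] by (simp add: field_simps)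

lemma tendsto_N [tendsto_intros]:
  assumes "(g \<longlongrightarrow> l) F"
  shows "((\<lambda>x. N (g x)) \<longlongrightarrow> N l) F"
proof (rule LIM_zero_cancel, rule Lim_null_comparison)
  show "\<forall>\<^sub>F x in F. norm (N (g x) - N l) \<le> hi * norm (g x - l)"
    using N_reverse_triangle le_hi by (intro always_eventually) (metis order_trans real_norm_def)
  show "((\<lambda>x. hi * norm (g x - l)) \<longlongrightarrow> 0) F"
    using assms by (auto intro!: tendsto_eq_intros)
qed

text \<open>The step bounds sum to at most \<open>4 * l\<close>. This yields the limit in each
  coordinate and places it at distance at most \<open>4 * l\<close> from every iterate, uniformly in
  \<open>n\<close>.\<close>

lemma geometric_steps:
  assumes step: "\<And>n. N (y (Suc n) - y n) \<le> 2 * l * (1/2) ^ n"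
  shows "convergent y" and "y \<longlonglongrightarrow> yb \<Longrightarrow> N (yb - y n) \<le> 4 * l"
proof -
  have "norm (y (Suc n) - y n) \<le> 4 * l / lo * (1/2) ^ Suc n" for n
  proof -
    have "N (y (Suc n) - y n) / lo \<le> 2 * l * (1/2) ^ n / lo"
      using lo by (intro divide_right_mono step) simp
    then show ?thesis
      using norm_le[of "y (Suc n) - y n"] by simp
  qed
  then have "summable (\<lambda>n. y (Suc n) - y n)"
    by (rule geometric_series_tail)
  then have "convergent (\<lambda>n. y 0 + (y n - y 0))"
    by (intro convergent_add convergent_const)
      (simp add: summable_iff_convergent sum_lessThan_telescope)
  then show "convergent y"
    by simp
  have l: "0 \<le> l"
    using step[of 0] N_nonneg[of "y (Suc 0) - y 0"] by simp
  \<comment> \<open>The exact partial sum of the step bounds is kept, since the induction would not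
    close with the bound \<open>4 * l\<close> alone.\<close>
  have *: "N (y (k + n) - y n) \<le> 4 * l * ((1/2) ^ n - (1/2) ^ (k + n))" for k
  proof (induction k)
    case 0
    then show ?case by (simp add: N_0)
  next
    case (Suc k)
    then show ?case
      using N_triangle[of "y (Suc (k + n)) - y (k + n)" "y (k + n) - y n"] step[of "k + n"]
      by (simp add: algebra_simps)
  qed
  have "N (y (k + n) - y n) \<le> 4 * l" for k
  proof -
    have "(1/2) ^ n - (1/2) ^ (k + n) \<le> (1::real)"
      using power_le_one[of "1/2::real" n] zero_le_power[of "1/2::real" "k + n"] by linarith
    then show ?thesis
      using *[of k] mult_left_mono[of _ 1 "4 * l"] l by fastforce
  qed
  moreover assume "y \<longlonglongrightarrow> yb"
  then have "(\<lambda>k. N (y (k + n) - y n)) \<longlonglongrightarrow> N (yb - y n)"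
    by (intro tendsto_intros LIMSEQ_ignore_initial_segment)
  ultimately show "N (yb - y n) \<le> 4 * l"
    by (intro LIMSEQ_le_const2) auto
qed

section \<open>The squared norm, its derivative and series of its translates\<close>

text \<open>Squaring removes the kink of \<open>N\<close> at the origin, so penalties may be
  differentiated even at their own centres.\<close>

definition sq :: "'a \<Rightarrow> real" where
  "sq x = (N x)\<^sup>2"

lemma sq_nonneg: "0 \<le> sq x"
  by (simp add: sq_def)

lemma sq_0: "sq 0 = 0"
  by (simp add: sq_def N_0)

lemma sq_eq_0: "sq x = 0 \<longleftrightarrow> x = 0"
  by (simp add: sq_def N_eq_0)

lemma tendsto_sq [tendsto_intros]: "(g \<longlongrightarrow> l) F \<Longrightarrow> ((\<lambda>x. sq (g x)) \<longlongrightarrow> sq l) F"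
  unfolding sq_def by (intro tendsto_intros)

lemma sq_lipschitz: "\<bar>sq (x + h) - sq x\<bar> \<le> N h * (2 * N x + N h)"
proof -
  have "\<bar>sq (x + h) - sq x\<bar> = \<bar>N (x + h) - N x\<bar> * (N (x + h) + N x)"
    using N_nonneg[of x] N_nonneg[of "x + h"]
    by (simp add: sq_def power2_eq_square square_diff_square_factored abs_mult)
  also have "\<dots> \<le> N h * (2 * N x + N h)"
    using N_reverse_triangle[of "x + h" x] N_triangle[of x h] N_nonneg
    by (intro mult_mono) (auto simp: add_nonneg_nonneg)
  finally show ?thesis .
qed

text \<open>At the origin \<open>sq\<close> is bounded by a multiple of the squared norm, so its
  derivative vanishes; elsewhere the chain rule applies. The derivative is packaged as an element of
  the dual.\<close>

lemma sq_differentiable: "\<exists>D. (sq has_derivative blinfun_apply D) (at x)"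
proof (cases "x = 0")
  case True
  have "(sq has_derivative (\<lambda>h. 0)) (at 0)"
  proof (rule has_derivativeI_sandwich[where e = 1 and H = "\<lambda>y. hi\<^sup>2 * norm y"])
    show "norm (sq y - sq 0 - 0) / norm (y - 0) \<le> hi\<^sup>2 * norm y" if "y \<noteq> 0" for y
    proof -
      have "sq y \<le> (hi * norm y)\<^sup>2"
        unfolding sq_def by (intro power_mono le_hi N_nonneg)
      then show ?thesis
        using that by (simp add: sq_0 sq_nonneg field_simps power2_eq_square)
    qed
    show "((\<lambda>y. hi\<^sup>2 * norm y) \<longlongrightarrow> 0) (at 0)"
      by (auto intro!: tendsto_eq_intros)
  qed auto
  then show ?thesis
    using True by (intro exI[of _ 0]) (simp add: zero_blinfun.rep_eq)
next
  case False
  then have "sq differentiable (at x)"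
    unfolding sq_def[abs_def] by (intro differentiable_power N_differentiable)
  then obtain D where "(sq has_derivative D) (at x)"
    by (auto simp: differentiable_def)
  then show ?thesis
    using bounded_linear_Blinfun_apply has_derivative_bounded_linear by metis
qed

definition dsq :: "'a \<Rightarrow> 'a \<Rightarrow>\<^sub>L real" where
  "dsq x = (SOME D. (sq has_derivative blinfun_apply D) (at x))"

lemma sq_has_derivative: "(sq has_derivative blinfun_apply (dsq x)) (at x)"
  unfolding dsq_def using sq_differentiable by (rule someI_ex)

lemma sq_has_directional_derivative:
  "((\<lambda>t. sq (x + t *\<^sub>R h)) has_real_derivative blinfun_apply (dsq x) h) (at 0)"
proof -
  have "((\<lambda>t. x + t *\<^sub>R h) has_derivative (\<lambda>t. t *\<^sub>R h)) (at 0)"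
    by (auto intro!: derivative_eq_intros)
  then have "((\<lambda>t. sq (x + t *\<^sub>R h)) has_derivative (\<lambda>t. blinfun_apply (dsq x) (t *\<^sub>R h))) (at 0)"
    by (rule has_derivative_compose) (simp add: sq_has_derivative)
  moreover have "(\<lambda>t. blinfun_apply (dsq x) (t *\<^sub>R h)) = (*) (blinfun_apply (dsq x) h)"
    by (rule ext) (simp add: blinfun.scaleR_right)
  ultimately show ?thesis
    by (simp only: has_field_derivative_def)
qed

text \<open>Euler's identity for a function that is homogeneous of degree two.\<close>

lemma dsq_self: "blinfun_apply (dsq x) x = 2 * sq x"
proof (rule DERIV_unique[OF sq_has_directional_derivative])
  have "sq (x + t *\<^sub>R x) = (1 + t)\<^sup>2 * sq x" for t
    using N_scaleR[of "1 + t" x] by (simp add: sq_def scaleR_add_left power_mult_distrib)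
  then show "((\<lambda>t. sq (x + t *\<^sub>R x)) has_real_derivative 2 * sq x) (at 0)"
    by (auto intro!: derivative_eq_intros)
qed

text \<open>The difference quotients in direction \<open>h\<close> are bounded by
  \<open>sq_lipschitz\<close>; let \<open>t\<close> tend to 0. The linear growth in
  \<open>N x\<close> controls the slope of the perturbation.\<close>

lemma norm_dsq_le: "norm (dsq x) \<le> 2 * hi * N x"
proof (rule norm_blinfun_bound)
  show "0 \<le> 2 * hi * N x"
    using hi N_nonneg by simp
  fix h
  have "((\<lambda>t. (sq (x + t *\<^sub>R h) - sq x) / t) \<longlongrightarrow> blinfun_apply (dsq x) h) (at 0)"
    using sq_has_directional_derivative[of x h] by (simp add: DERIV_def)
  then have lim: "((\<lambda>t. \<bar>(sq (x + t *\<^sub>R h) - sq x) / t\<bar>) \<longlongrightarrow> \<bar>blinfun_apply (dsq x) h\<bar>) (at 0)"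
    by (rule tendsto_rabs)
  have lim': "((\<lambda>t. N h * (2 * N x + \<bar>t\<bar> * N h)) \<longlongrightarrow> N h * (2 * N x)) (at 0)"
    by (auto intro!: tendsto_eq_intros)
  have "\<bar>(sq (x + t *\<^sub>R h) - sq x) / t\<bar> \<le> N h * (2 * N x + \<bar>t\<bar> * N h)" if "t \<noteq> 0" for t
    using sq_lipschitz[of x "t *\<^sub>R h"] that by (simp add: N_scaleR abs_divide field_simps)
  then have "\<forall>\<^sub>F t in at 0. \<bar>(sq (x + t *\<^sub>R h) - sq x) / t\<bar> \<le> N h * (2 * N x + \<bar>t\<bar> * N h)"
    by (auto simp: eventually_at_filter)
  with lim' lim have "\<bar>blinfun_apply (dsq x) h\<bar> \<le> N h * (2 * N x)"
    by (rule tendsto_le[OF trivial_limit_at])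
  also have "\<dots> \<le> hi * norm h * (2 * N x)"
    using le_hi N_nonneg by (intro mult_right_mono) auto
  finally show "norm (blinfun_apply (dsq x) h) \<le> 2 * hi * N x * norm h"
    by (simp add: mult_ac)
qed

text \<open>Termwise differentiation is justified by uniform convergence of the derivatives on a
  ball around \<open>v\<close>. The bound on \<open>L\<close> uses only distances from
  \<open>v\<close> itself, hence \<open>R\<close> and not the larger constant valid on the
  ball.\<close>

lemma sq_series_has_derivative:
  assumes p: "\<And>j. N (v - p j) \<le> R"
  obtains L where
    "((\<lambda>u. \<Sum>j. (1/2) ^ Suc j * sq (u - p j)) has_derivative blinfun_apply L) (at v)"
    "norm L \<le> 2 * hi * R"
proof -
  define D where "D u j = (1/2) ^ Suc j *\<^sub>R dsq (u - p j)" for u j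
  have norm_D: "norm (D u j) \<le> 2 * hi * b * (1/2) ^ Suc j" if "N (u - p j) \<le> b" for u j b
  proof -
    have "norm (dsq (u - p j)) \<le> 2 * hi * b"
      using norm_dsq_le[of "u - p j"] mult_left_mono[OF that, of "2 * hi"] hi by linarith
    then show ?thesis
      using mult_right_mono[of _ _ "(1/2) ^ Suc j"] by (fastforce simp: D_def mult.commute)
  qed
  \<comment> \<open>Points of the unit ball are uniformly close to all centres, so one geometric
    tail serves the whole ball.\<close>
  have ball: "N (u - p j) \<le> R + hi" if "u \<in> ball v 1" for u j
  proof -
    have "hi * norm (u - v) \<le> hi * 1"
      using that hi by (intro mult_left_mono) (auto simp: dist_norm norm_minus_commute)
    then show ?thesis
      using le_hi[of "u - v"] N_triangle[of "u - v" "v - p j"] p[of j] by simp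
  qed
  have sq_summable: "summable (\<lambda>j. (1/2) ^ Suc j * sq (v - p j))"
  proof (rule geometric_series_tail)
    show "norm ((1/2) ^ Suc j * sq (v - p j)) \<le> R\<^sup>2 * (1/2) ^ Suc j" for j
      using power_mono[OF p N_nonneg, of j 2] by (simp add: sq_def)
  qed
  have "\<exists>g. \<forall>u\<in>ball v 1. (\<lambda>j. (1/2) ^ Suc j * sq (u - p j)) sums g u \<and>
      (g has_derivative (\<lambda>h. blinfun_apply (\<Sum>j. D u j) h)) (at u within ball v 1)"
  proof (rule has_derivative_series[OF convex_ball, where f' = "\<lambda>j u h. blinfun_apply (D u j) h"])
    fix j u
    have "((\<lambda>u. sq (u - p j)) has_derivative blinfun_apply (dsq (u - p j))) (at u within ball v 1)"
      by (rule has_derivative_compose[where f = "\<lambda>u. u - p j" and g = sq, OF _ sq_has_derivative])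
        (auto intro!: derivative_eq_intros)
    then show "((\<lambda>u. (1/2) ^ Suc j * sq (u - p j)) has_derivative blinfun_apply (D u j)) (at u within ball v 1)"
      unfolding D_def blinfun.scaleR_left real_scaleR_def by (rule has_derivative_mult_right)
  next
    fix e :: real assume "0 < e"
    have "((\<lambda>n. 2 * hi * (R + hi) * (1/2) ^ n) \<longlonglongrightarrow> 0)"
      by (intro tendsto_mult_right_zero LIMSEQ_power_zero) simp
    then have "\<forall>\<^sub>F n in sequentially. 2 * hi * (R + hi) * (1/2) ^ n < e"
      using \<open>0 < e\<close> by (rule order_tendstoD)
    then show "\<forall>\<^sub>F n in sequentially. \<forall>u\<in>ball v 1. \<forall>h.
        norm ((\<Sum>j<n. blinfun_apply (D u j) h) - blinfun_apply (\<Sum>j. D u j) h) \<le> e * norm h"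
    proof eventually_elim
      case (elim n)
      show ?case
      proof (intro ballI allI)
        fix u h assume u: "u \<in> ball v 1"
        have "norm ((\<Sum>j<n. blinfun_apply (D u j) h) - blinfun_apply (\<Sum>j. D u j) h)
            = norm (blinfun_apply ((\<Sum>j. D u j) - (\<Sum>j<n. D u j)) h)"
          by (simp add: blinfun.diff_left blinfun.sum_left abs_minus_commute)
        also have "\<dots> \<le> norm ((\<Sum>j. D u j) - (\<Sum>j<n. D u j)) * norm h"
          by (rule norm_blinfun)
        also have "\<dots> \<le> e * norm h"
          using geometric_series_tail(2)[of "D u", OF norm_D[OF ball[OF u]], of n] elim
          by (intro mult_right_mono) auto
        finally show "norm ((\<Sum>j<n. blinfun_apply (D u j) h) - blinfun_apply (\<Sum>j. D u j) h) \<le> e * norm h" .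
      qed
    qed
  next
    show "v \<in> ball v 1" by simp
    show "(\<lambda>j. (1/2) ^ Suc j * sq (v - p j)) sums (\<Sum>j. (1/2) ^ Suc j * sq (v - p j))"
      using sq_summable by (rule summable_sums)
  qed
  then obtain g where g: "\<And>u. u \<in> ball v 1 \<Longrightarrow> (\<lambda>j. (1/2) ^ Suc j * sq (u - p j)) sums g u"
      "(g has_derivative blinfun_apply (\<Sum>j. D v j)) (at v within ball v 1)"
    by (metis centre_in_ball zero_less_one)
  have "(g has_derivative blinfun_apply (\<Sum>j. D v j)) (at v)"
    using g(2) by (simp add: at_within_open[of v "ball v 1"])
  then have "((\<lambda>u. \<Sum>j. (1/2) ^ Suc j * sq (u - p j)) has_derivative blinfun_apply (\<Sum>j. D v j)) (at v)"
    by (rule has_derivative_transform_within_open[OF _ open_ball _ sums_unique[OF g(1)]]) simp_all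
  moreover have "norm (\<Sum>j. D v j) \<le> 2 * hi * R"
    using geometric_series_tail(2)[of "D v" "2 * hi * R" 0] norm_D[OF p] by simp
  ultimately show thesis
    by (rule that)
qed

section \<open>Almost normals at a perturbed minimizer\<close>

text \<open>The quantitative core at a fixed shift size \<open>r\<close> and step length
  \<open>l\<close>. \<open>E\<close> collects the partial derivatives of the distance function and
  \<open>L\<close> those of the perturbation; the slope \<open>r / l\<close> is traded against the
  displacement \<open>4 * l / lo\<close>.\<close>

lemma almost_extremal_normals:
  fixes \<Omega> :: "nat \<Rightarrow> 'a set" and a :: "nat \<Rightarrow> 'a" and m :: nat
  assumes m: "2 \<le> m"
    and closed: "\<And>i. i \<in> {1..m} \<Longrightarrow> closed (\<Omega> i \<inter> cball x R)"
    and x: "\<And>i. i \<in> {1..m} \<Longrightarrow> x \<in> \<Omega> i"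
    and a: "\<And>i. i \<in> {1..m} \<Longrightarrow> norm (a i) \<le> r"
    and r: "0 < r" and l: "0 < l" and lR: "4 * l / lo < R" and d: "4 * l / lo + r \<le> d"
    and empty: "(\<Inter>i\<in>{1..m}. (\<lambda>y. y - a i) ` \<Omega> i) \<inter> cball x d = {}"
  obtains y E L where
    "\<And>i. i \<in> {1..m} \<Longrightarrow> y i \<in> \<Omega> i"
    "\<And>i. i \<in> {1..m} \<Longrightarrow> norm (y i - x) \<le> 4 * l / lo"
    "\<And>i. i \<in> {1..m} \<Longrightarrow> - (E i + L i) \<in> frechet_normal_cone (y i) (\<Omega> i)"
    "\<And>i. i \<in> {1..m} \<Longrightarrow> norm (L i) \<le> 16 * real m * hi\<^sup>2 * r / l"
    "(\<Sum>i=1..m. E i) = 0"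
    "lo \<le> (\<Sum>i=1..m. norm (E i))"
proof -
  \<comment> \<open>All differences \<open>w y k\<close> vanish exactly when the shifted points
    \<open>y k - a k\<close> coincide; \<open>w y m\<close> is always zero.\<close>
  define w where "w y k = y k - a k - (y m - a m)" for y k
  define f where "f y = sqrt (\<Sum>k=1..<m. sq (w y k))" for y
  define Q where "Q v u = (\<Sum>i=1..m. sq (v i - u i))" for v u :: "nat \<Rightarrow> 'a"
  define S where "S = Pi {1..m} (\<lambda>i. \<Omega> i \<inter> cball x R)"
  define conv where "conv z y \<longleftrightarrow> (\<forall>i\<in>{1..m}. (\<lambda>n. z n i) \<longlonglongrightarrow> y i)"
    for z :: "nat \<Rightarrow> nat \<Rightarrow> 'a" and y
  \<comment> \<open>\<open>e\<close> bounds \<open>f\<close> at the constant starting point. The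
    choice of \<open>c\<close> makes \<open>4 * e / c\<close> equal to \<open>4 * l\<^sup>2\<close>,
    so that the steps have length at most \<open>2 * l * (1/2) ^ n\<close>.\<close>
  define e where "e = 2 * real m * hi * r"
  define c where "c = e / l\<^sup>2"
  have e: "0 < e" and c: "0 < c"
    using m hi r l by (auto simp: e_def c_def)
  have R: "0 < R"
    using lR l lo by (smt (verit) divide_pos_pos)

  have f_start: "f (\<lambda>_. x) \<le> e"
    unfolding f_def
  proof (rule real_le_lsqrt)
    have "sq (w (\<lambda>_. x) k) \<le> (2 * hi * r)\<^sup>2" if "k \<in> {1..<m}" for k
    proof -
      have "norm (w (\<lambda>_. x) k) \<le> 2 * r"
        using norm_triangle_ineq4[of "a m" "a k"] a[of k] a[of m] that by (simp add: w_def)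
      then have "N (w (\<lambda>_. x) k) \<le> hi * (2 * r)"
        using le_hi hi by (meson less_imp_le mult_left_mono order_trans)
      then show ?thesis
        unfolding sq_def by (intro power_mono N_nonneg) simp
    qed
    then have "(\<Sum>k=1..<m. sq (w (\<lambda>_. x) k)) \<le> of_nat (card {1..<m}) * (2 * hi * r)\<^sup>2"
      by (rule sum_bounded_above)
    also have "\<dots> \<le> (real m)\<^sup>2 * (2 * hi * r)\<^sup>2"
    proof (intro mult_right_mono)
      have "real (card {1..<m}) \<le> real m"
        by simp
      also have "\<dots> \<le> (real m)\<^sup>2"
        using m by (intro self_le_power) auto
      finally show "real (card {1..<m}) \<le> (real m)\<^sup>2" .
    qed simp
    also have "\<dots> = e\<^sup>2"
      by (simp add: e_def power_mult_distrib)
    finally show "(\<Sum>k=1..<m. sq (w (\<lambda>_. x) k)) \<le> e\<^sup>2" .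
  qed (use e in simp_all)

  have sq_bound: "sq (v i - u i) \<le> (2 * hi * R)\<^sup>2" if "v \<in> S" "u \<in> S" "i \<in> {1..m}" for v u i
  proof -
    have "norm (v i - u i) \<le> 2 * R"
      using dist_triangle2[of "v i" "u i" x] that
      by (force simp: S_def Pi_iff dist_norm norm_minus_commute)
    then have "N (v i - u i) \<le> hi * (2 * R)"
      using le_hi hi by (meson less_imp_le mult_left_mono order_trans)
    then show ?thesis
      unfolding sq_def by (intro power_mono N_nonneg) simp
  qed

  have N_step: "N (z (Suc n) i - z n i) \<le> 2 * l * (1/2) ^ n"
    if "Q (z (Suc n)) (z n) \<le> 4 * e / c * (1/8) ^ n" "i \<in> {1..m}" for z n i
  proof (rule power2_le_imp_le)
    have "(N (z (Suc n) i - z n i))\<^sup>2 \<le> Q (z (Suc n)) (z n)"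
      unfolding Q_def sq_def[symmetric] using that(2) by (intro member_le_sum) (auto simp: sq_nonneg)
    also have "\<dots> \<le> 4 * l\<^sup>2 * (1/8) ^ n"
      using that(1) e l by (simp add: c_def)
    \<comment> \<open>Weakening 1/8 to 1/4 makes the bound a perfect square.\<close>
    also have "\<dots> \<le> 4 * l\<^sup>2 * (1/4) ^ n"
      by (intro mult_left_mono power_mono) auto
    also have "\<dots> = (2 * l * (1/2) ^ n)\<^sup>2"
      by (simp add: power_mult_distrib power2_eq_square flip: power_mult_distrib)
    finally show "(N (z (Suc n) i - z n i))\<^sup>2 \<le> (2 * l * (1/2) ^ n)\<^sup>2" .
  qed (use l in simp)

  obtain z y where zS: "\<And>n. z n \<in> S" and z0: "z 0 = (\<lambda>_. x)" and yS: "y \<in> S" and y: "conv z y"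
    and z_step: "\<And>n. Q (z (Suc n)) (z n) \<le> 4 * e / c * (1/8) ^ n"
    and y_min: "\<And>v. v \<in> S \<Longrightarrow> f y + c * (\<Sum>j. (1/2) ^ Suc j * Q y (z j))
        \<le> f v + c * (\<Sum>j. (1/2) ^ Suc j * Q v (z j))"
  proof (rule smooth_variational_principle[where S = S and f = f and Q = Q and conv = conv
        and e = e and c = c and B = "of_nat (card {1..m}) * (2 * hi * R)\<^sup>2" and ?z0.0 = "\<lambda>_. x"])
    show "(\<lambda>_. x) \<in> S"
      using x R by (simp add: S_def)
    show "0 \<le> f v" for v
      by (simp add: f_def sum_nonneg sq_nonneg)
    show "Q v u \<le> of_nat (card {1..m}) * (2 * hi * R)\<^sup>2" if "v \<in> S" "u \<in> S" for v u
      unfolding Q_def using sq_bound that by (intro sum_bounded_above)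
    show "\<exists>y\<in>S. conv z y"
      if zS: "\<And>n. z n \<in> S" and z: "\<And>n. Q (z (Suc n)) (z n) \<le> 4 * e / c * (1/8) ^ n" for z
    proof -
      define y where "y i = lim (\<lambda>n. z n i)" for i
      have lim: "(\<lambda>n. z n i) \<longlonglongrightarrow> y i" if "i \<in> {1..m}" for i
        unfolding y_def convergent_LIMSEQ_iff[symmetric]
        using N_step[OF z that] by (rule geometric_steps(1))
      have "y i \<in> \<Omega> i \<inter> cball x R" if "i \<in> {1..m}" for i
        using closed_sequentially[OF closed[OF that] _ lim[OF that]] zS that
        by (simp add: S_def Pi_iff)
      then show ?thesis
        using lim by (intro bexI[of _ y]) (simp_all add: conv_def S_def)
    qed
    show "(\<lambda>n. f (z n)) \<longlonglongrightarrow> f y" if "conv z y" for z y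
      unfolding f_def w_def using that m by (intro tendsto_intros) (auto simp: conv_def)
    show "(\<lambda>n. Q (z n) u) \<longlonglongrightarrow> Q y u" if "conv z y" for z y u
      unfolding Q_def using that by (intro tendsto_intros) (auto simp: conv_def)
  qed (rule f_start e c | (rule that; assumption) | simp add: Q_def sum_nonneg sq_nonneg sq_0)+

  have N_y_z: "N (y i - z n i) \<le> 4 * l" if "i \<in> {1..m}" for i n
    using geometric_steps(2)[OF N_step[OF z_step that]] y that unfolding conv_def by simp
  have y_near: "norm (y i - x) \<le> 4 * l / lo" if "i \<in> {1..m}" for i
  proof -
    have "N (y i - x) / lo \<le> 4 * l / lo"
      using N_y_z[OF that, of 0] lo by (simp add: z0 divide_right_mono)
    then show ?thesis
      using norm_le[of "y i - x"] by linarith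
  qed

  \<comment> \<open>The norm of the differences is differentiable at \<open>y\<close> only because it does not vanish there.\<close>
  have f_pos: "0 < f y"
  proof (rule ccontr)
    assume "\<not> 0 < f y"
    then have "(\<Sum>k=1..<m. sq (w y k)) = 0"
      using sum_nonneg[of "{1..<m}" "\<lambda>k. sq (w y k)"] by (simp add: f_def sq_nonneg)
    then have "w y k = 0" if "k \<in> {1..<m}" for k
      using that by (simp add: sum_nonneg_eq_0_iff sq_nonneg sq_eq_0)
    then have same: "y k - a k = y m - a m" if "k \<in> {1..m}" for k
      using that by (cases "k = m") (auto simp: w_def)
    \<comment> \<open>The common value of the shifted points lies in every translated set and within
      \<open>4 * l / lo + r\<close> of \<open>x\<close>, hence in the ball excluded by
      \<open>empty\<close>.\<close>
    have "y m - a m \<in> (\<lambda>u. u - a k) ` \<Omega> k" if "k \<in> {1..m}" for k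
      using same[OF that] yS that by (intro image_eqI[of _ _ "y k"]) (auto simp: S_def)
    moreover have "norm (y m - a m - x) \<le> d"
      using norm_triangle_ineq4[of "y m - x" "a m"] y_near[of m] a[of m] m d
      by (simp add: algebra_simps)
    then have "y m - a m \<in> cball x d"
      by (simp add: dist_norm norm_minus_commute)
    ultimately show False
      using empty by blast
  qed
  define F where "F = f y"
  have F: "0 < F" "F\<^sup>2 = (\<Sum>k=1..<m. sq (w y k))"
    using f_pos by (auto simp: F_def f_def sum_nonneg sq_nonneg)

  \<comment> \<open>Moving the \<open>i\<close>-th point by \<open>h\<close> moves the \<open>k\<close>-th difference by \<open>coef k i *\<^sub>R h\<close>.\<close>
  define coef :: "nat \<Rightarrow> nat \<Rightarrow> real" where "coef k i = of_bool (i = k) - of_bool (i = m)" for k i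
  define E where "E i = (\<Sum>k=1..<m. (coef k i / (2 * F)) *\<^sub>R dsq (w y k))" for i
  define G where "G i u = (\<Sum>j. (1/2) ^ Suc j * sq (u - z j i))" for i u
  have "\<exists>L. (G i has_derivative blinfun_apply L) (at (y i)) \<and> norm L \<le> 2 * hi * (4 * l)"
    if "i \<in> {1..m}" for i
    unfolding G_def by (rule sq_series_has_derivative[of "y i" "\<lambda>j. z j i" "4 * l"]) (use N_y_z[OF that] in blast)+
  then obtain L where L: "\<And>i. i \<in> {1..m} \<Longrightarrow> (G i has_derivative blinfun_apply (L i)) (at (y i))"
      "\<And>i. i \<in> {1..m} \<Longrightarrow> norm (L i) \<le> 2 * hi * (4 * l)"
    by metis

  have f_deriv: "((\<lambda>u. f (y(i := u))) has_derivative blinfun_apply (E i)) (at (y i))"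
    if i: "i \<in> {1..m}" for i
  proof -
    have w_upd: "w (y(i := u)) k = w y k + coef k i *\<^sub>R (u - y i)" if "k \<in> {1..<m}" for u k
      using that by (auto simp: w_def coef_def)
    have f_upd: "f (y(i := u)) = sqrt (\<Sum>k=1..<m. sq (w y k + coef k i *\<^sub>R (u - y i)))" for u
      unfolding f_def by (intro arg_cong[where f = sqrt] sum.cong) (simp_all only: w_upd)
    have "((\<lambda>u. sq (w y k + coef k i *\<^sub>R (u - y i))) has_derivative
        (\<lambda>h. blinfun_apply (dsq (w y k)) (coef k i *\<^sub>R h))) (at (y i))" for k
      by (rule has_derivative_compose[where f = "\<lambda>u. w y k + coef k i *\<^sub>R (u - y i)" and g = sq])
        (auto intro!: derivative_eq_intros sq_has_derivative)
    then have "((\<lambda>u. \<Sum>k=1..<m. sq (w y k + coef k i *\<^sub>R (u - y i))) has_derivative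
        (\<lambda>h. \<Sum>k=1..<m. blinfun_apply (dsq (w y k)) (coef k i *\<^sub>R h))) (at (y i))"
      by (intro has_derivative_sum)
    from has_derivative_real_sqrt[OF _ this]
    have "((\<lambda>u. f (y(i := u))) has_derivative
        (\<lambda>h. (\<Sum>k=1..<m. blinfun_apply (dsq (w y k)) (coef k i *\<^sub>R h)) * (inverse F / 2))) (at (y i))"
      unfolding f_upd using F f_pos by (simp add: F_def f_def)
    moreover have "(\<lambda>h. (\<Sum>k=1..<m. blinfun_apply (dsq (w y k)) (coef k i *\<^sub>R h)) * (inverse F / 2))
        = blinfun_apply (E i)"
      using F by (auto simp: E_def blinfun.sum_left blinfun.scaleR_left blinfun.scaleR_right
          sum_distrib_right divide_simps intro!: sum.cong)
    ultimately show ?thesis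
      by simp
  qed

  \<comment> \<open>The perturbation separates into functions of single coordinates, so varying one
    point leaves the remaining terms unchanged.\<close>
  have Q_series: "(\<Sum>j. (1/2) ^ Suc j * Q v (z j)) = (\<Sum>i=1..m. G i (v i))" if v: "v \<in> S" for v
  proof -
    have "summable (\<lambda>j. (1/2) ^ Suc j * sq (v i - z j i))" if "i \<in> {1..m}" for i
    proof (rule geometric_series_tail)
      show "norm ((1/2) ^ Suc j * sq (v i - z j i)) \<le> (2 * hi * R)\<^sup>2 * (1/2) ^ Suc j" for j
        using sq_bound[OF v zS that, of j] sq_nonneg[of "v i - z j i"] by (simp add: abs_mult)
    qed
    then show ?thesis
      unfolding G_def Q_def sum_distrib_left by (rule suminf_sum)
  qed

  have normal: "- (E i + c *\<^sub>R L i) \<in> frechet_normal_cone (y i) (\<Omega> i)" if i: "i \<in> {1..m}" for i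
  proof (rule frechet_normal_cone_of_local_min)
    show "((\<lambda>u. f (y(i := u)) + c * G i u) has_derivative blinfun_apply (E i + c *\<^sub>R L i)) (at (y i))"
      unfolding blinfun.add_left blinfun.scaleR_left real_scaleR_def
      by (intro has_derivative_add has_derivative_mult_right f_deriv L i)
    \<comment> \<open>By \<open>lR\<close> the point \<open>y i\<close> is interior to the ball of
      radius \<open>R\<close>, so minimality over the truncated set is local minimality over
      \<open>\<Omega> i\<close>.\<close>
    have "\<forall>\<^sub>F u in at (y i) within \<Omega> i. u \<in> ball x R \<and> u \<in> \<Omega> i"
      unfolding eventually_at_topological using y_near[OF i] lR
      by (intro exI[of _ "ball x R"]) (simp add: dist_norm norm_minus_commute)
    then show "\<forall>\<^sub>F u in at (y i) within \<Omega> i. f (y(i := y i)) + c * G i (y i) \<le> f (y(i := u)) + c * G i u"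
    proof eventually_elim
      case (elim u)
      then have "y(i := u) \<in> S"
        using yS by (auto simp: S_def)
      from y_min[OF this] have "f y + c * (\<Sum>k=1..m. G k (y k))
          \<le> f (y(i := u)) + c * (\<Sum>k=1..m. G k ((y(i := u)) k))"
        unfolding Q_series[OF yS] Q_series[OF \<open>y(i := u) \<in> S\<close>] .
      moreover have "(\<Sum>k=1..m. G k ((y(i := u)) k)) = G i u + (\<Sum>k\<in>{1..m} - {i}. G k (y k))"
        using i by (subst sum.remove[of _ i]) auto
      moreover have "(\<Sum>k=1..m. G k (y k)) = G i (y i) + (\<Sum>k\<in>{1..m} - {i}. G k (y k))"
        using i by (intro sum.remove) auto
      ultimately show ?case
        by (simp add: distrib_left)
    qed
  qed

  show thesis
  proof (rule that)
    show "y i \<in> \<Omega> i" if "i \<in> {1..m}" for i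
      using yS that by (auto simp: S_def)
    show "norm (c *\<^sub>R L i) \<le> 16 * real m * hi\<^sup>2 * r / l" if "i \<in> {1..m}" for i
    proof -
      have "norm (c *\<^sub>R L i) \<le> c * (2 * hi * (4 * l))"
        using c L(2)[OF that] by (simp add: mult_left_mono)
      also have "\<dots> = 16 * real m * hi\<^sup>2 * r / l"
        using l by (simp add: c_def e_def power2_eq_square)
      finally show ?thesis .
    qed
    \<comment> \<open>Each \<open>dsq (w y k)\<close> occurs with coefficient 1 at
      \<open>i = k\<close> and -1 at \<open>i = m\<close>, and the two cancel.\<close>
    have "(\<Sum>i=1..m. E i) = (\<Sum>k=1..<m. (\<Sum>i=1..m. coef k i *\<^sub>R ((1 / (2 * F)) *\<^sub>R dsq (w y k))))"
      unfolding E_def by (subst sum.swap) simp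
    also have "\<dots> = 0"
    proof (rule sum.neutral, rule ballI)
      fix k assume "k \<in> {1..<m}"
      then show "(\<Sum>i=1..m. coef k i *\<^sub>R ((1 / (2 * F)) *\<^sub>R dsq (w y k))) = 0"
        unfolding coef_def using m by (subst sum_of_bool_diff_scaleR) auto
    qed
    finally show "(\<Sum>i=1..m. E i) = 0" .
    \<comment> \<open>Moving every \<open>y i\<close> in direction \<open>w y i\<close> rescales all
      differences, as \<open>w y m = 0\<close>. Since \<open>f\<close> is homogeneous of degree one
      in them, its derivative in this direction is \<open>F\<close>. As each difference has norm at
      most \<open>F / lo\<close>, cancelling \<open>F\<close> gives the lower bound on the norms of
      the \<open>E i\<close>.\<close>
    have "F\<^sup>2 = F * (\<Sum>i=1..m. blinfun_apply (E i) (w y i))"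
    proof -
      have "(\<Sum>i=1..m. blinfun_apply (E i) (w y i))
          = (\<Sum>k=1..<m. (\<Sum>i=1..m. coef k i *\<^sub>R (blinfun_apply (dsq (w y k)) (w y i) / (2 * F))))"
        unfolding E_def blinfun.sum_left by (subst sum.swap) (simp add: blinfun.scaleR_left)
      also have "\<dots> = (\<Sum>k=1..<m. sq (w y k) / F)"
      proof (intro sum.cong refl)
        fix k assume "k \<in> {1..<m}"
        then have "(\<Sum>i=1..m. coef k i *\<^sub>R (blinfun_apply (dsq (w y k)) (w y i) / (2 * F)))
            = blinfun_apply (dsq (w y k)) (w y k) / (2 * F) - blinfun_apply (dsq (w y k)) (w y m) / (2 * F)"
          unfolding coef_def using m by (intro sum_of_bool_diff_scaleR) auto
        also have "\<dots> = sq (w y k) / F"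
          by (simp add: dsq_self w_def blinfun.zero_right)
        finally show "(\<Sum>i=1..m. coef k i *\<^sub>R (blinfun_apply (dsq (w y k)) (w y i) / (2 * F))) = sq (w y k) / F" .
      qed
      also have "\<dots> = F\<^sup>2 / F"
        by (simp add: F(2) sum_divide_distrib)
      finally show ?thesis
        using F(1) by (simp add: power2_eq_square)
    qed
    then have "F = (\<Sum>i=1..m. blinfun_apply (E i) (w y i))"
      using F(1) by (simp add: power2_eq_square)
    also have "\<dots> \<le> (\<Sum>i=1..m. norm (E i) * (F / lo))"
    proof (rule sum_mono)
      fix i assume i: "i \<in> {1..m}"
      have "N (w y i) \<le> F"
      proof (cases "i = m")
        case True
        have "w y i = 0"
          unfolding w_def True by (rule diff_self)
        then show ?thesis
          using F(1) by (simp only: N_0 less_imp_le)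
      next
        case False
        then have "sq (w y i) \<le> F\<^sup>2"
          unfolding F(2) using i by (intro member_le_sum) (auto simp: sq_nonneg)
        then show ?thesis
          unfolding sq_def by (rule power2_le_imp_le) (rule less_imp_le[OF F(1)])
      qed
      then have "N (w y i) / lo \<le> F / lo"
        using lo by (intro divide_right_mono) auto
      then have "norm (w y i) \<le> F / lo"
        using norm_le[of "w y i"] by linarith
      have "blinfun_apply (E i) (w y i) \<le> norm (E i) * norm (w y i)"
        using norm_blinfun[of "E i" "w y i"] by (simp only: real_norm_def abs_le_iff)
      also have "\<dots> \<le> norm (E i) * (F / lo)"
        by (intro mult_left_mono \<open>norm (w y i) \<le> F / lo\<close> norm_ge_zero)
      finally show "blinfun_apply (E i) (w y i) \<le> norm (E i) * (F / lo)" .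
    qed
    also have "\<dots> = F * ((\<Sum>i=1..m. norm (E i)) / lo)"
      unfolding sum_divide_distrib sum_distrib_left by (intro sum.cong refl) (simp only: times_divide_eq_right mult.commute)
    finally have "F * 1 \<le> F * ((\<Sum>i=1..m. norm (E i)) / lo)"
      by (simp only: mult_1_right)
    then have "1 \<le> (\<Sum>i=1..m. norm (E i)) / lo"
      by (simp only: mult_le_cancel_left_pos[OF F(1)])
    then show "lo \<le> (\<Sum>i=1..m. norm (E i))"
      using lo by simp
  qed (rule y_near normal; assumption)+
qed

end

section \<open>From rated extremality to the approximate extremal principle\<close>

theorem theorem3p7:
  fixes \<Omega> :: "nat \<Rightarrow> 'a::banach set" and xbar :: 'a and \<alpha> :: real and m :: nat
  assumes "has_equivalent_frechet_smooth_norm TYPE('a)"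
    and "m \<ge> 2"
    and "0 \<le> \<alpha>" and "\<alpha> < 1"
    and "\<forall>i\<in>{1..m}. locally_closed_around (\<Omega> i) xbar"
    and "rated_extremal_point \<alpha> m \<Omega> xbar"
  shows "approximate_extremal_principle m \<Omega> xbar"
proof -
  have m: "0 < real m" "{1..m} \<noteq> {}"
    using assms(2) by auto
  obtain N :: "'a \<Rightarrow> real" and lo hi where N: "frechet_smooth_norm N lo hi"
  proof -
    obtain N :: "'a \<Rightarrow> real" where N: "equivalent_norm N" "\<And>x. x \<noteq> 0 \<Longrightarrow> N differentiable (at x)"
      using assms(1) unfolding has_equivalent_frechet_smooth_norm_def by blast
    obtain lo hi where "0 < lo" "0 < hi" "\<And>x. lo * norm x \<le> N x \<and> N x \<le> hi * norm x"
      using N(1) unfolding equivalent_norm_def by blast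
    then have "frechet_smooth_norm N lo hi"
      using N by (simp add: frechet_smooth_norm_def equivalent_norm_def)
    then show thesis
      by (rule that)
  qed
  interpret frechet_smooth_norm N lo hi
    by (rule N)

  have "\<forall>i\<in>{1..m}. \<exists>\<rho>>0. closed (\<Omega> i \<inter> cball xbar \<rho>)"
    using assms(5) unfolding locally_closed_around_def .
  then obtain \<rho> where \<rho>: "\<And>i. i \<in> {1..m} \<Longrightarrow> 0 < \<rho> i \<and> closed (\<Omega> i \<inter> cball xbar (\<rho> i))"
    by metis
  define R where "R = Min (\<rho> ` {1..m})"
  have R: "0 < R"
    using \<rho> m by (simp add: R_def)
  have closed: "closed (\<Omega> i \<inter> cball xbar R)" if "i \<in> {1..m}" for i
  proof -
    have "R \<le> \<rho> i"
      using that by (simp add: R_def)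
    then have "\<Omega> i \<inter> cball xbar R = (\<Omega> i \<inter> cball xbar (\<rho> i)) \<inter> cball xbar R"
      by auto
    then show ?thesis
      using \<rho>[OF that] by (metis closed_Int closed_cball)
  qed

  obtain \<gamma> a where \<gamma>: "0 < \<gamma>" and mem: "\<And>i. i \<in> {1..m} \<Longrightarrow> xbar \<in> \<Omega> i"
    and lim_r: "(\<lambda>k. Max ((\<lambda>i. norm (a i k)) ` {1..m})) \<longlonglongrightarrow> 0"
    and empty: "\<forall>\<^sub>F k in sequentially. (\<Inter>i\<in>{1..m}. (\<lambda>y. y - a i k) ` \<Omega> i) \<inter>
        cball xbar (\<gamma> * Max ((\<lambda>i. norm (a i k)) ` {1..m}) powr \<alpha>) = {}"
    using assms(6) unfolding rated_extremal_point_def Let_def by auto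
  define r where "r k = Max ((\<lambda>i. norm (a i k)) ` {1..m})" for k
  have a_le: "norm (a i k) \<le> r k" if "i \<in> {1..m}" for i k
    unfolding r_def using that by simp
  \<comment> \<open>If all shifts vanished, \<open>xbar\<close> itself would lie in the intersection
    that extremality makes empty. Positivity gives access to the laws of real powers and to limits
    from the right.\<close>
  have r_pos: "\<forall>\<^sub>F k in sequentially. 0 < r k"
    using empty
  proof eventually_elim
    case (elim k)
    show ?case
    proof (rule ccontr)
      assume "\<not> 0 < r k"
      then have "a i k = 0" if "i \<in> {1..m}" for i
        using a_le[OF that, of k] by (simp add: norm_le_zero_iff[symmetric] del: norm_le_zero_iff)
      then have "xbar \<in> (\<Inter>i\<in>{1..m}. (\<lambda>y. y - a i k) ` \<Omega> i)"
        using mem by (force intro: image_eqI)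
      moreover have "xbar \<in> cball xbar (\<gamma> * Max ((\<lambda>i. norm (a i k)) ` {1..m}) powr \<alpha>)"
        using \<gamma> by simp
      ultimately show False
        using elim by blast
    qed
  qed
  moreover have "r \<longlonglongrightarrow> 0"
    unfolding r_def[abs_def] by (rule lim_r)
  ultimately have r: "filterlim r (at_right 0) sequentially"
    unfolding filterlim_at by (auto elim: eventually_mono)

  show ?thesis
    unfolding approximate_extremal_principle_def
  proof (intro allI impI)
    fix \<epsilon> :: real assume \<epsilon>: "0 < \<epsilon>"
    \<comment> \<open>With step length \<open>r powr \<beta>\<close> the minimizer stays in the ball of radius \<open>\<gamma> * r powr \<alpha>\<close>
      because \<open>\<alpha> < \<beta>\<close>, and the perturbation slope \<open>r / r powr \<beta>\<close> vanishes because \<open>\<beta> < 1\<close>.\<close>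
    define \<delta> where "\<delta> = (1 - \<alpha>) / 2"
    define \<beta> where "\<beta> = \<alpha> + \<delta>"
    have \<delta>: "0 < \<delta>" and \<beta>: "0 < \<beta>" and \<beta>\<delta>: "\<beta> + \<delta> = 1" "\<alpha> + \<delta> = \<beta>" "\<alpha> + 2 * \<delta> = 1"
      using assms(3,4) by (auto simp: \<delta>_def \<beta>_def field_simps)
    have powr_lim: "((\<lambda>s. s powr p) \<longlongrightarrow> 0) (at_right 0)" if "0 < p" for p :: real
      using tendsto_neg_powr[of "- p" "inverse" "at_right 0"] that filterlim_inverse_at_top_right
      by (simp add: powr_minus inverse_powr)
    have small: "\<forall>\<^sub>F k in sequentially. C * r k powr p < b" if "0 < p" "0 < b" for C p b :: real
    proof -
      have "((\<lambda>k. C * r k powr p) \<longlongrightarrow> C * 0) sequentially"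
        by (intro tendsto_mult_left filterlim_compose[OF powr_lim r] that)
      then show ?thesis
        using that by (intro order_tendstoD) auto
    qed
    \<comment> \<open>In order, the smallness conditions keep the minimizer interior to the ball of
      radius \<open>R\<close>, keep it within \<epsilon> of \<open>xbar\<close>, fit the two parts
      of the displacement into the extremality ball, and make the perturbation slope small against
      the lower bound \<open>lo / m\<close> for \<open>T\<close>.\<close>
    have "\<forall>\<^sub>F k in sequentially. 0 < r k \<and>
        (\<Inter>i\<in>{1..m}. (\<lambda>y. y - a i k) ` \<Omega> i) \<inter> cball xbar (\<gamma> * r k powr \<alpha>) = {} \<and>
        4 / lo * r k powr \<beta> < R \<and> 4 / lo * r k powr \<beta> < \<epsilon> \<and>
        4 / lo * r k powr \<delta> < \<gamma> / 2 \<and> 1 * r k powr (2 * \<delta>) < \<gamma> / 2 \<and>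
        16 * real m * hi\<^sup>2 * r k powr \<delta> < \<epsilon> * (lo / m)"
      using empty unfolding r_def[symmetric]
      using r_pos lo m \<delta> \<beta> R \<epsilon> \<gamma> by (intro eventually_conj small) auto
    then obtain k where k: "0 < r k"
        "(\<Inter>i\<in>{1..m}. (\<lambda>y. y - a i k) ` \<Omega> i) \<inter> cball xbar (\<gamma> * r k powr \<alpha>) = {}"
        "4 / lo * r k powr \<beta> < R" "4 / lo * r k powr \<beta> < \<epsilon>"
        "4 / lo * r k powr \<delta> < \<gamma> / 2" "r k powr (2 * \<delta>) < \<gamma> / 2"
        "16 * real m * hi\<^sup>2 * r k powr \<delta> < \<epsilon> * (lo / m)"
      by (auto dest!: eventually_happens)
    \<comment> \<open>Factoring out \<open>r k powr \<alpha>\<close> leaves two terms with positive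
      exponents \<delta> and \<open>2 * \<delta>\<close>, each below
      \<open>\<gamma> / 2\<close>.\<close>
    have "4 * r k powr \<beta> / lo + r k = r k powr \<alpha> * (4 / lo * r k powr \<delta> + r k powr (2 * \<delta>))"
    proof -
      have "r k powr \<alpha> * r k powr \<delta> = r k powr \<beta>" "r k powr \<alpha> * r k powr (2 * \<delta>) = r k"
        using k(1) \<beta>\<delta> by (simp_all add: powr_add[symmetric])
      then show ?thesis
        by (simp add: distrib_left mult.left_commute)
    qed
    also have "\<dots> \<le> r k powr \<alpha> * \<gamma>"
      using k(5,6) by (intro mult_left_mono) auto
    finally have d: "4 * r k powr \<beta> / lo + r k \<le> \<gamma> * r k powr \<alpha>"
      by (simp add: mult.commute)
    have slope: "r k / r k powr \<beta> = r k powr \<delta>"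
    proof -
      have "r k powr \<beta> * r k powr \<delta> = r k"
        using k(1) by (simp add: \<beta>\<delta>(1) flip: powr_add)
      then show ?thesis
        using k(1) by (simp add: field_simps)
    qed
    obtain y E L where y: "\<And>i. i \<in> {1..m} \<Longrightarrow> y i \<in> \<Omega> i"
        "\<And>i. i \<in> {1..m} \<Longrightarrow> norm (y i - xbar) \<le> 4 * r k powr \<beta> / lo"
      and normal: "\<And>i. i \<in> {1..m} \<Longrightarrow> - (E i + L i) \<in> frechet_normal_cone (y i) (\<Omega> i)"
      and L: "\<And>i. i \<in> {1..m} \<Longrightarrow> norm (L i) \<le> 16 * real m * hi\<^sup>2 * r k / r k powr \<beta>"
      and E: "(\<Sum>i=1..m. E i) = 0" "lo \<le> (\<Sum>i=1..m. norm (E i))"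
    proof (rule almost_extremal_normals[of m \<Omega> xbar R "\<lambda>i. a i k" "r k" "r k powr \<beta>" "\<gamma> * r k powr \<alpha>"])
      show "4 * r k powr \<beta> / lo < R"
        using k(3) by simp
      show "0 < r k powr \<beta>"
        using k(1) by simp
    qed (rule assms(2) closed mem a_le k(1,2) d | (rule that; assumption) | assumption)+

    \<comment> \<open>\<open>T\<close> is the normalizing factor. Each \<open>norm (E i)\<close> is
      at most \<open>T\<close>, so the lower bound \<open>lo\<close> on their sum gives
      \<open>T \<ge> lo / m\<close>, independently of \<open>k\<close> and \<epsilon>.\<close>
    define T where "T = sqrt (\<Sum>i=1..m. (norm (E i))\<^sup>2)"
    have "norm (E i) \<le> T" if "i \<in> {1..m}" for i
      unfolding T_def using that by (intro real_le_rsqrt member_le_sum) auto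
    then have "(\<Sum>i=1..m. norm (E i)) \<le> of_nat (card {1..m}) * T"
      by (rule sum_bounded_above)
    with E(2) have "lo \<le> T * m"
      by (simp add: mult.commute)
    then have T_ge: "lo / m \<le> T"
      using m(1) by (simp only: pos_divide_le_eq)
    moreover have "0 < lo / m"
      using lo m by simp
    ultimately have T: "0 < T"
      by linarith
    have T2: "T\<^sup>2 = (\<Sum>i=1..m. (norm (E i))\<^sup>2)"
      by (simp add: T_def sum_nonneg)
    define y' where "y' i = - ((1 / T) *\<^sub>R E i)" for i
    have "y' i \<in> frechet_normal_cone (y i) (\<Omega> i) + cball 0 \<epsilon>" if i: "i \<in> {1..m}" for i
    proof -
      \<comment> \<open>Normalization keeps the first summand in the cone and turns the perturbation
        slope into an error of norm at most \<epsilon>.\<close>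
      have "y' i = (1 / T) *\<^sub>R (- (E i + L i)) + (1 / T) *\<^sub>R L i"
        by (simp add: y'_def scaleR_right_diff_distrib)
      moreover have "(1 / T) *\<^sub>R (- (E i + L i)) \<in> frechet_normal_cone (y i) (\<Omega> i)"
        using T by (intro frechet_normal_cone_scaleR normal i) simp
      moreover have "norm (L i) \<le> \<epsilon> * T"
      proof -
        have "norm (L i) \<le> 16 * real m * hi\<^sup>2 * r k powr \<delta>"
          using L[OF i] unfolding slope[symmetric] by simp
        also have "\<dots> \<le> \<epsilon> * T"
          using k(7) mult_left_mono[OF T_ge, of \<epsilon>] \<epsilon> by linarith
        finally show ?thesis .
      qed
      then have "(1 / T) *\<^sub>R L i \<in> cball 0 \<epsilon>"
        using T by (simp add: field_simps)
      ultimately show ?thesis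
        by (metis set_plus_intro)
    qed
    moreover have "y i \<in> \<Omega> i \<inter> cball xbar \<epsilon>" if "i \<in> {1..m}" for i
      using y[OF that] k(4) by (simp add: dist_norm norm_minus_commute)
    moreover have "(\<Sum>i=1..m. y' i) = 0"
      unfolding y'_def sum_negf scaleR_sum_right[symmetric] E(1) by simp
    moreover have "(\<Sum>i=1..m. (norm (y' i))\<^sup>2) = 1"
    proof -
      have "(norm (y' i))\<^sup>2 = (norm (E i))\<^sup>2 / T\<^sup>2" for i
        by (simp add: y'_def power_divide)
      then have "(\<Sum>i=1..m. (norm (y' i))\<^sup>2) = T\<^sup>2 / T\<^sup>2"
        by (simp only: T2 sum_divide_distrib)
      then show ?thesis
        using T by simp
    qed
    ultimately show "\<exists>(y :: nat \<Rightarrow> 'a) (y' :: nat \<Rightarrow> 'a \<Rightarrow>\<^sub>L real).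
        (\<forall>i\<in>{1..m}. y i \<in> \<Omega> i \<inter> cball xbar \<epsilon> \<and>
                    y' i \<in> frechet_normal_cone (y i) (\<Omega> i) + cball 0 \<epsilon>) \<and>
        (\<Sum>i=1..m. y' i) = 0 \<and> (\<Sum>i=1..m. (norm (y' i))\<^sup>2) = 1"
      by (intro exI[of _ y] exI[of _ y'] conjI ballI)
  qed
qed

end
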